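(* Let $k$ be a positive integer, let $G=(V,E,\partial)$ be a finite undirected graph, and let $v_1,v_2,v_3,v_4$ be four different vertices of $G$. There exist $k$ chains of edges $p_1,\ldots,p_k$ in $G$, no two of which have a common nontrivial summand, such that $\partial(p_1)=\cdots=\partial(p_k)=v_1+v_2+v_3+v_4$, if and only if there is a set of edges (possibly empty) whose deletion from $G$ yields a graph $G'$ in which every vertex $y\notin\{v_1,v_2,v_3,v_4\}$ has even degree and such that after the deletion of any $k-1$ or fewer edges from $G'$ there still exists a chain of edges $p$ in it with $\partial(p)=v_1+v_2+v_3+v_4$.
   Context: A graph $G=(V,E,\partial)$ consists of a finite nonempty vertex set $V$, a finite edge set $E$, and a map $\partial$ assigning to each edge a set of exactly two distinct vertices (parallel edges allowed, no loops). The degree of a vertex $v$ is the number of edges $e$ with $v\in\partial(e)$. $A(S)$ is the $\mathbb{F}_2$-vector space of formal $\mathbb{F}_2$-linear combinations of elements of $S$; elements of $A(E)$ are chains of edges, with summands the edges of coefficient $1$. Two chains have no common nontrivial summand if no edge is a summand of both. $\partial$ extends $\mathbb{F}_2$-linearly to $A(E)\to A(V)$, sending an edge to the sum of its two endpoints. Deleting edges means removing them from $E$ (the vertex set is unchanged). *)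

theory Defs
  imports Main "HOL-Library.Poly_Mapping" "HOL-Library.Z2"
begin

record ('v, 'e) multigraph =
  verts :: "'v set"
  edges :: "'e set"
  ends :: "'e \<Rightarrow> 'v set"

text \<open>Only the values of \<^term>\<open>ends G\<close> on \<^term>\<open>edges G\<close> are constrained and used.\<close>

definition finite_multigraph :: "('v, 'e) multigraph \<Rightarrow> bool" where
  "finite_multigraph G \<longleftrightarrow>
     finite (verts G) \<and> verts G \<noteq> {} \<and> finite (edges G) \<and>
     (\<forall>e\<in>edges G. ends G e \<subseteq> verts G \<and> card (ends G e) = 2)"

definition vertex_degree :: "('v, 'e) multigraph \<Rightarrow> 'v \<Rightarrow> nat" where
  "vertex_degree G v = card {e \<in> edges G. v \<in> ends G e}"

definition delete_edges :: "('v, 'e) multigraph \<Rightarrow> 'e set \<Rightarrow> ('v, 'e) multigraph" where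
  "delete_edges G D = G\<lparr>edges := edges G - D\<rparr>"

text \<open>The type \<open>'a \<Rightarrow>\<^sub>0 bit\<close> consists of the formal linear combinations over the two-element
  field; the summands of a chain are its \<^const>\<open>Poly_Mapping.keys\<close>.\<close>

type_synonym 'a chain = "'a \<Rightarrow>\<^sub>0 bit"

definition chains_on :: "'a set \<Rightarrow> 'a chain set" where
  "chains_on S = {c. Poly_Mapping.keys c \<subseteq> S}"

definition gen :: "'a \<Rightarrow> 'a chain" where
  "gen x = Poly_Mapping.single x 1"

definition no_common_summand :: "'a chain \<Rightarrow> 'a chain \<Rightarrow> bool" where
  "no_common_summand c d \<longleftrightarrow> Poly_Mapping.keys c \<inter> Poly_Mapping.keys d = {}"

text \<open>Every summand has coefficient 1, so no scalar factor is needed in the linear extension;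
  linearity is confirmed by the lemmas below.\<close>

definition boundary :: "('v, 'e) multigraph \<Rightarrow> 'e chain \<Rightarrow> 'v chain" where
  "boundary G c = (\<Sum>e\<in>Poly_Mapping.keys c. \<Sum>v\<in>ends G e. gen v)"

lemma boundary_gen: "boundary G (gen e) = (\<Sum>v\<in>ends G e. gen v)"
  by (simp add: boundary_def gen_def)

lemma chain_add_self: "(c :: 'a chain) + c = 0"
  by (rule poly_mapping_eqI) (simp add: lookup_add)

lemma keys_add_chain: "Poly_Mapping.keys (c + d :: 'a chain) = (Poly_Mapping.keys c - Poly_Mapping.keys d) \<union> (Poly_Mapping.keys d - Poly_Mapping.keys c)"
proof -
  have "x \<in> Poly_Mapping.keys (c + d) \<longleftrightarrow> (x \<in> Poly_Mapping.keys c) \<noteq> (x \<in> Poly_Mapping.keys d)" for x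
    by (cases "Poly_Mapping.lookup c x"; cases "Poly_Mapping.lookup d x") (simp_all add: in_keys_iff lookup_add)
  then show ?thesis by blast
qed

lemma boundary_add: "boundary G (c + d) = boundary G c + boundary G d"
proof -
  let ?f = "\<lambda>e. \<Sum>v\<in>ends G e. gen v"
  let ?C = "Poly_Mapping.keys c - Poly_Mapping.keys d" and ?D = "Poly_Mapping.keys d - Poly_Mapping.keys c" and ?B = "Poly_Mapping.keys c \<inter> Poly_Mapping.keys d"
  have c: "boundary G c = sum ?f ?C + sum ?f ?B"
    unfolding boundary_def by (subst sum.union_disjoint [symmetric]) (auto intro!: sum.cong)
  have d: "boundary G d = sum ?f ?D + sum ?f ?B"
    unfolding boundary_def by (subst sum.union_disjoint [symmetric]) (auto intro!: sum.cong)
  have "boundary G (c + d) = sum ?f ?C + sum ?f ?D"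
    unfolding boundary_def keys_add_chain by (rule sum.union_disjoint) auto
  also have "\<dots> = sum ?f ?C + sum ?f ?D + (sum ?f ?B + sum ?f ?B)"
    by (simp add: chain_add_self)
  also have "\<dots> = boundary G c + boundary G d"
    unfolding c d by (simp only: ac_simps)
  finally show ?thesis .
qed

end

theory Submission
  imports Defs
begin

text \<open>If \<open>k\<close> disjoint chains exist, keep only their edges: fewer than \<open>k\<close> deletions
  cannot meet all of them. Conversely, robustness says that every cut separating one of the four
  terminals from the other three has at least \<open>k\<close> edges. As in proofs of the Lovasz--Cherkassky theorem,
  an edge \<open>vu\<close> from a terminal to a non-terminal can be split off together with some edge \<open>uw\<close>
  (both are replaced by one edge \<open>vw\<close>) without destroying this condition, and disjoint chains of the
  smaller graph lift back. Once no edge joins a terminal to a non-terminal, one is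
  left with a multigraph on four vertices of minimum degree at least \<open>k\<close>, where
  perfect matchings can be peeled off and vertices of degree at least \<open>k + 2\<close> can be split.\<close>

section \<open>Cuts, joins and packings of joins\<close>

definition crosses :: "('e \<Rightarrow> 'v set) \<Rightarrow> 'v set \<Rightarrow> 'e \<Rightarrow> bool" where
  "crosses N X e \<longleftrightarrow> N e \<inter> X \<noteq> {} \<and> \<not> N e \<subseteq> X"

definition cut_size :: "'e set \<Rightarrow> ('e \<Rightarrow> 'v set) \<Rightarrow> 'v set \<Rightarrow> nat" where
  "cut_size E N X = card {e \<in> E. crosses N X e}"

text \<open>The classical \<open>T\<close>-joins. Over the two-element field a chain is the set of
  its summands, and its boundary is the sum of the vertices that meet an odd number of them;
  disjoint chains with boundary \<open>T\<close> are thus disjoint \<open>T\<close>-joins.\<close>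

definition tjoin :: "'e set \<Rightarrow> ('e \<Rightarrow> 'v set) \<Rightarrow> 'v set \<Rightarrow> 'e set \<Rightarrow> bool" where
  "tjoin E N T p \<longleftrightarrow> p \<subseteq> E \<and> (\<forall>x. odd (card {e \<in> p. x \<in> N e}) \<longleftrightarrow> x \<in> T)"

definition packable :: "'e set \<Rightarrow> ('e \<Rightarrow> 'v set) \<Rightarrow> 'v set \<Rightarrow> nat \<Rightarrow> bool" where
  "packable E N T k \<longleftrightarrow>
     (\<exists>P. (\<forall>i<k. tjoin E N T (P i)) \<and> (\<forall>i<k. \<forall>j<k. i \<noteq> j \<longrightarrow> P i \<inter> P j = {}))"

section \<open>Uncrossing inequalities and parity of cuts\<close>

text \<open>In this form, inequalities between sums of cut sizes can be checked edge by edge, on the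
  two ends of a single edge.\<close>

lemma cut_size_sum: "finite E \<Longrightarrow> cut_size E N X = (\<Sum>e\<in>E. of_bool (crosses N X e))"
  by (simp add: cut_size_def sum_of_bool_eq Collect_conj_eq)

lemma cut_size_insert:
  assumes "finite E" "e \<notin> E"
  shows "cut_size (insert e E) N X = of_bool (crosses N X e) + cut_size E N X"
proof -
  have "{g \<in> insert e E. crosses N X g} = (if crosses N X e then {e} else {}) \<union> {g \<in> E. crosses N X g}"
    by auto
  then show ?thesis using assms by (auto simp: cut_size_def)
qed

lemma crosses_pair: "N e = {a, b} \<Longrightarrow> crosses N X e \<longleftrightarrow> (a \<in> X) \<noteq> (b \<in> X)"
  by (auto simp: crosses_def)

lemma cut_size_submodular:
  assumes "finite E" "\<forall>e\<in>E. card (N e) = 2"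
  shows "cut_size E N (X \<inter> Y) + cut_size E N (X \<union> Y) \<le> cut_size E N X + cut_size E N Y"
  unfolding cut_size_sum[OF assms(1)] sum.distrib[symmetric]
proof (rule sum_mono)
  fix e assume "e \<in> E"
  then obtain a b where "N e = {a, b}" using assms(2) by (auto simp: card_2_iff)
  then show "of_bool (crosses N (X \<inter> Y) e) + of_bool (crosses N (X \<union> Y) e)
      \<le> (of_bool (crosses N X e) + of_bool (crosses N Y e) :: nat)"
    by (auto simp: crosses_pair of_bool_def)
qed

text \<open>An edge from the intersection of \<open>X\<close> and \<open>Y\<close> to the outside of
  their union crosses both \<open>X\<close> and \<open>Y\<close> but neither difference, so
  \<open>g\<close> makes the usual inequality strict.\<close>

lemma cut_size_posimodular_strict:
  assumes "finite E" "\<forall>e\<in>E. card (N e) = 2" "g \<in> E" "N g = {u, v}"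
    "u \<in> X \<inter> Y" "v \<notin> X \<union> Y"
  shows "cut_size E N (X - Y) + cut_size E N (Y - X) < cut_size E N X + cut_size E N Y"
  unfolding cut_size_sum[OF assms(1)] sum.distrib[symmetric]
proof (rule sum_strict_mono_ex1[OF assms(1)])
  show "\<forall>e\<in>E. of_bool (crosses N (X - Y) e) + of_bool (crosses N (Y - X) e)
      \<le> (of_bool (crosses N X e) + of_bool (crosses N Y e) :: nat)"
  proof
    fix e assume "e \<in> E"
    then obtain a b where "N e = {a, b}" using assms(2) by (auto simp: card_2_iff)
    then show "of_bool (crosses N (X - Y) e) + of_bool (crosses N (Y - X) e)
        \<le> (of_bool (crosses N X e) + of_bool (crosses N Y e) :: nat)"
      by (auto simp: crosses_pair of_bool_def)
  qed
  show "\<exists>e\<in>E. of_bool (crosses N (X - Y) e) + of_bool (crosses N (Y - X) e)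
      < (of_bool (crosses N X e) + of_bool (crosses N Y e) :: nat)"
    using assms(3-) by (intro bexI[of _ g]) (auto simp: crosses_pair)
qed

text \<open>Double counting: the degree sum over \<open>X\<close> counts each edge once per end in
  \<open>X\<close>, and an edge crosses \<open>X\<close> exactly when that number is odd.\<close>

lemma cut_size_parity:
  assumes "finite E" "\<forall>e\<in>E. card (N e) = 2" "finite X"
  shows "even (cut_size E N X) \<longleftrightarrow> even (\<Sum>x\<in>X. card {e \<in> E. x \<in> N e})"
proof -
  have "(\<Sum>x\<in>X. card {e \<in> E. x \<in> N e}) = (\<Sum>x\<in>X. \<Sum>e\<in>E. of_bool (x \<in> N e))"
    using assms(1) by (simp add: sum_of_bool_eq Collect_conj_eq)
  also have "\<dots> = (\<Sum>e\<in>E. \<Sum>x\<in>X. of_bool (x \<in> N e))" by (rule sum.swap)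
  also have "\<dots> = (\<Sum>e\<in>E. card (X \<inter> N e))"
    using assms(3) by (simp add: sum_of_bool_eq)
  finally have *: "(\<Sum>x\<in>X. card {e \<in> E. x \<in> N e}) = (\<Sum>e\<in>E. card (X \<inter> N e))" .
  have "even (\<Sum>e\<in>E. of_bool (crosses N X e) + card (X \<inter> N e))"
  proof (rule dvd_sum)
    fix e assume "e \<in> E"
    then obtain a b where "N e = {a, b}" "a \<noteq> b" using assms(2) by (auto simp: card_2_iff)
    then show "even (of_bool (crosses N X e) + card (X \<inter> N e))"
      by (cases "a \<in> X"; cases "b \<in> X") (auto simp: crosses_pair Int_insert_right)
  qed
  then show ?thesis
    unfolding * cut_size_sum[OF assms(1)] sum.distrib by simp
qed

section \<open>Extending packings and lifting them along a splitting\<close>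

lemma tjoin_mono: "tjoin E' N T p \<Longrightarrow> E' \<subseteq> E \<Longrightarrow> tjoin E N T p"
  by (auto simp: tjoin_def)

lemma packable_mono: "packable E' N T k \<Longrightarrow> E' \<subseteq> E \<Longrightarrow> packable E N T k"
  unfolding packable_def by (metis tjoin_mono)

lemma packable_add:
  assumes "packable E N T k" "E \<subseteq> E'" "tjoin E' N T p" "p \<inter> E = {}"
  shows "packable E' N T (Suc k)"
proof -
  obtain P where P: "\<forall>i<k. tjoin E N T (P i)" "\<forall>i<k. \<forall>j<k. i \<noteq> j \<longrightarrow> P i \<inter> P j = {}"
    using assms(1) by (auto simp: packable_def)
  have new: "P i \<inter> p = {}" "tjoin E' N T (P i)" if "i < k" for i
    using P(1) that assms(2,4) unfolding tjoin_def by blast+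
  show ?thesis
    unfolding packable_def
  proof (intro exI[of _ "P(k := p)"] conjI allI impI)
    fix i assume "i < Suc k"
    then show "tjoin E' N T ((P(k := p)) i)" using new assms(3) by (auto simp: less_Suc_eq)
  next
    fix i j assume "i < Suc k" "j < Suc k" "i \<noteq> j"
    then show "(P(k := p)) i \<inter> (P(k := p)) j = {}"
      using new(1) new(1)[unfolded Int_commute[of _ p]] P(2)
      by (cases "i = k"; cases "j = k") (simp_all add: less_Suc_eq)
  qed
qed

text \<open>The split edge \<open>vw\<close> keeps the name \<open>e\<close>, while \<open>f\<close>
  disappears. A join using the new \<open>e\<close> is lifted by rerouting it along \<open>e\<close>
  and \<open>f\<close> through \<open>u\<close>: the degrees at \<open>v\<close> and
  \<open>w\<close> stay the same and the degree at \<open>u\<close> grows by two.\<close>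

lemma packable_split:
  assumes "packable (E - {f}) (N(e := {v, w})) T k"
    and "finite E" "e \<in> E" "f \<in> E" "e \<noteq> f" "N e = {v, u}" "N f = {u, w}"
    and "u \<noteq> v" "u \<noteq> w" "v \<noteq> w"
  shows "packable E N T k"
proof -
  let ?N = "N(e := {v, w})"
  define L where "L p = (if e \<in> p then insert f p else p)" for p
  obtain P where P: "\<forall>i<k. tjoin (E - {f}) ?N T (P i)"
      "\<forall>i<k. \<forall>j<k. i \<noteq> j \<longrightarrow> P i \<inter> P j = {}"
    using assms(1) by (auto simp: packable_def)
  have L: "tjoin E N T (L p)" if p: "tjoin (E - {f}) ?N T p" for p
  proof -
    have "f \<notin> p" "finite p" using p assms(2) by (auto simp: tjoin_def intro: finite_subset)
    have "even (card {g \<in> L p. x \<in> N g}) \<longleftrightarrow> even (card {g \<in> p. x \<in> ?N g})" for x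
    proof (cases "e \<in> p")
      case False
      then have "{g \<in> L p. x \<in> N g} = {g \<in> p. x \<in> ?N g}" by (auto simp: L_def)
      then show ?thesis by simp
    next
      case True
      let ?R = "{g \<in> p - {e}. x \<in> N g}"
      have R: "finite ?R" "e \<notin> ?R" "f \<notin> ?R" using \<open>finite p\<close> \<open>f \<notin> p\<close> by auto
      have "{g \<in> L p. x \<in> N g} = {g \<in> {e, f}. x \<in> N g} \<union> ?R"
        using True by (auto simp: L_def)
      moreover have "{g \<in> {e, f}. x \<in> N g} =
          (if x \<in> N e then {e} else {}) \<union> (if x \<in> N f then {f} else {})" by auto
      moreover have "{g \<in> p. x \<in> ?N g} = (if x = v \<or> x = w then {e} else {}) \<union> ?R"
        using True by auto
      ultimately show ?thesis
        using R assms(5-) by auto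
    qed
    moreover have "L p \<subseteq> E" using p assms(4) by (auto simp: tjoin_def L_def)
    ultimately show ?thesis using p by (simp add: tjoin_def)
  qed
  \<comment> \<open>No \<open>P i\<close> contains \<open>f\<close> and at most one contains
    \<open>e\<close>, so \<open>f\<close> is inserted into at most one member.\<close>
  have "L (P i) \<inter> L (P j) = {}" if "i < k" "j < k" "i \<noteq> j" for i j
  proof -
    have "P i \<inter> P j = {}" "f \<notin> P i" "f \<notin> P j" using P that by (auto simp: tjoin_def)
    then show ?thesis by (auto simp: L_def)
  qed
  then show ?thesis
    unfolding packable_def using L P(1) by (intro exI[of _ "\<lambda>i. L (P i)"]) auto
qed

section \<open>Effect of splitting on cuts, and admissible splittings\<close>

text \<open>The edge \<open>vw\<close> crosses \<open>X\<close> exactly when one and only one of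
  \<open>e\<close> and \<open>f\<close> does. So a cut changes only if both cross it, and then it
  loses two edges; its parity is always preserved.\<close>

lemma cut_size_split:
  assumes "finite E" "e \<in> E" "f \<in> E" "e \<noteq> f" "N e = {v, u}" "N f = {u, w}"
  shows "cut_size (E - {f}) (N(e := {v, w})) X + 2 * of_bool (crosses N X e \<and> crosses N X f)
    = cut_size E N X"
proof -
  let ?N = "N(e := {v, w})" and ?R = "E - {f} - {e}"
  have "{g \<in> ?R. crosses ?N X g} = {g \<in> ?R. crosses N X g}" by (auto simp: crosses_def)
  then have R: "cut_size ?R ?N X = cut_size ?R N X" by (simp add: cut_size_def)
  have E: "E - {f} = insert e ?R" "E = insert f (insert e ?R)" using assms by auto
  have fin: "finite ?R" "e \<notin> ?R" "f \<notin> insert e ?R" using assms by auto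
  have "cut_size (E - {f}) ?N X = of_bool (crosses ?N X e) + cut_size ?R N X"
    using cut_size_insert[OF fin(1,2), of ?N X] R E(1) by metis
  moreover have "cut_size E N X = of_bool (crosses N X f) + (of_bool (crosses N X e) + cut_size ?R N X)"
    using cut_size_insert[OF _ fin(3), of N X] cut_size_insert[OF fin(1,2), of N X] fin(1) E(2)
    by (metis finite_insert)
  ultimately show ?thesis
    using crosses_pair[of N e v u X] crosses_pair[of N f u w X] crosses_pair[of ?N e v w X] assms(5,6)
    by auto
qed

text \<open>This is splitting in the case \<open>w = v\<close>, where the new edge would be a loop
  and is dropped. The cut identity has the same form as in \<open>cut_size_split\<close>, so both
  cases can be treated alike.\<close>

lemma cut_size_delete_parallel:
  assumes "finite E" "e \<in> E" "f \<in> E" "e \<noteq> f" "N e = {v, u}" "N f = {u, v}"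
  shows "cut_size (E - {e, f}) N X + 2 * of_bool (crosses N X e \<and> crosses N X f)
    = cut_size E N X"
proof -
  let ?R = "E - {e, f}"
  have fin: "finite ?R" "e \<notin> ?R" "f \<notin> insert e ?R" and E: "E = insert f (insert e ?R)"
    using assms by auto
  have "cut_size E N X = of_bool (crosses N X f) + (of_bool (crosses N X e) + cut_size ?R N X)"
    using cut_size_insert[OF _ fin(3), of N X] cut_size_insert[OF fin(1,2), of N X] fin(1) E
    by (metis finite_insert)
  then show ?thesis
    using crosses_pair[of N e v u X] crosses_pair[of N f u v X] assms(5,6) by auto
qed

text \<open>The parity clause is what remains of the evenness of the degrees outside \<open>T\<close>; in this form
  it is visibly stable under splitting off.\<close>

definition feasible :: "'v set \<Rightarrow> 'e set \<Rightarrow> ('e \<Rightarrow> 'v set) \<Rightarrow> 'v set \<Rightarrow> nat \<Rightarrow> bool" where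
  "feasible V E N T k \<longleftrightarrow> finite V \<and> finite E \<and> T \<subseteq> V \<and>
     (\<forall>e\<in>E. N e \<subseteq> V \<and> card (N e) = 2) \<and>
     (\<forall>t. \<forall>X\<subseteq>V. X \<inter> T = {t} \<longrightarrow>
        k \<le> cut_size E N X \<and> (even (cut_size E N X) \<longleftrightarrow> even (cut_size E N {t})))"

text \<open>Cuts of size at most \<open>k + 1\<close> are the minimal ones by parity. If no partner \<open>f\<close> of \<open>e\<close> were
  admissible, uncrossing would leave at most one maximal such set \<open>A\<close> around \<open>v\<close> avoiding \<open>u\<close> and
  one minimal such set \<open>B\<close> around another terminal containing \<open>u\<close>, and moving \<open>u\<close> into \<open>A\<close> and out
  of \<open>B\<close> would decrease the total size of the two cuts.\<close>

lemma admissible_split_exists: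
  assumes feas: "feasible V E N T k"
    and e: "e \<in> E" "N e = {v, u}" and v: "v \<in> T" and u: "u \<notin> T"
  obtains f w where "f \<in> E" "f \<noteq> e" "N f = {u, w}" "u \<noteq> w"
    "\<And>X t. X \<subseteq> V \<Longrightarrow> X \<inter> T = {t} \<Longrightarrow> crosses N X e \<Longrightarrow> crosses N X f \<Longrightarrow> k + 2 \<le> cut_size E N X"
proof (rule ccontr)
  note admissible = that
  assume neg: "\<not> thesis"
  let ?d = "cut_size E N"
  have fin: "finite V" "finite E" and TV: "T \<subseteq> V" and two: "\<forall>e\<in>E. card (N e) = 2"
    and NV: "\<forall>e\<in>E. N e \<subseteq> V"
    and cut: "\<forall>t. \<forall>X\<subseteq>V. X \<inter> T = {t} \<longrightarrow> k \<le> ?d X \<and> (even (?d X) \<longleftrightarrow> even (?d {t}))"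
    using feas by (simp_all add: feasible_def)
  have ge: "k \<le> ?d X" and par: "even (?d X) \<longleftrightarrow> even (?d {t})" if "X \<subseteq> V" "X \<inter> T = {t}" for X t
    using cut that by blast+
  have uV: "u \<in> V" and uv: "u \<noteq> v" using NV e u v by auto
  define tight where "tight t X \<longleftrightarrow> X \<subseteq> V \<and> X \<inter> T = {t} \<and> ?d X < k + 2" for t X
  have min: "?d X \<le> ?d Y" if "tight t X" "Y \<subseteq> V" "Y \<inter> T = {t}" for t X Y
  proof -
    have "even (?d X) \<longleftrightarrow> even (?d Y)" using par that unfolding tight_def by metis
    moreover have "?d X < k + 2" "k \<le> ?d Y" using ge that unfolding tight_def by auto
    moreover have "a \<le> b" if "even a \<longleftrightarrow> even b" "a < k + 2" "k \<le> b" for a b :: nat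
      using that by presburger
    ultimately show ?thesis by blast
  qed
  have bad: "\<exists>t X. tight t X \<and> crosses N X e \<and> crosses N X f"
    if "f \<in> E" "f \<noteq> e" "N f = {u, w}" "u \<noteq> w" for f w
  proof (rule ccontr)
    assume "\<not> ?thesis"
    then have "k + 2 \<le> ?d X"
      if "X \<subseteq> V" "X \<inter> T = {t}" "crosses N X e" "crosses N X f" for X t
      using that unfolding tight_def by (meson not_le)
    then show False using admissible[OF that] neg by blast
  qed
  \<comment> \<open>Submodularity bounds the two new cuts by the two old ones, and minimality of
    tight cuts bounds each from below, so both are again minimal.\<close>
  have un: "tight t (X \<union> Y) \<and> tight t (X \<inter> Y)" if "tight t X" "tight t Y" for t X Y
  proof -
    have "(X \<union> Y) \<inter> T = {t}" "(X \<inter> Y) \<inter> T = {t}" "X \<union> Y \<subseteq> V" "X \<inter> Y \<subseteq> V"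
      using that unfolding tight_def by auto
    then show ?thesis
      using min[OF that(1), of "X \<union> Y"] min[OF that(1), of "X \<inter> Y"]
        cut_size_submodular[OF fin(2) two, of X Y] that unfolding tight_def by auto
  qed
  \<comment> \<open>A tight set crossed by \<open>e\<close> contains exactly one of \<open>u\<close>
    and \<open>v\<close>. If it contains \<open>v\<close>, its terminal is \<open>v\<close> itself,
    because \<open>v\<close> lies in \<open>T\<close>; if it contains \<open>u\<close>, its terminal
    is some other one.\<close>
  define \<A> where "\<A> = {X. tight v X \<and> u \<notin> X}"
  define \<B> where "\<B> = {X. \<exists>t. tight t X \<and> u \<in> X \<and> v \<notin> X}"
  have "\<A> \<subseteq> Pow V" "\<B> \<subseteq> Pow V" unfolding \<A>_def \<B>_def tight_def by auto
  then have fAB: "finite \<A>" "finite \<B>" using fin by (auto intro: finite_subset)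
  \<comment> \<open>For different terminals the differences \<open>X - Y\<close> and
    \<open>Y - X\<close> are cuts of the same two kinds, and \<open>e\<close> runs from
    \<open>u\<close> in the intersection to \<open>v\<close> outside the union, so strict
    posimodularity contradicts minimality.\<close>
  have same: "t = s" if "tight t X" "tight s Y" "u \<in> X" "v \<notin> X" "u \<in> Y" "v \<notin> Y" for t s X Y
  proof (rule ccontr)
    assume "t \<noteq> s"
    then have "(X - Y) \<inter> T = {t}" "(Y - X) \<inter> T = {s}" "X - Y \<subseteq> V" "Y - X \<subseteq> V"
      using that unfolding tight_def by auto
    then have "?d X \<le> ?d (X - Y)" "?d Y \<le> ?d (Y - X)" using min that by auto
    then show False
      using cut_size_posimodular_strict[OF fin(2) two e(1), of u v X Y] e(2) that
      by (auto simp: insert_commute)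
  qed
  \<comment> \<open>A set crossed by both \<open>e\<close> and \<open>f\<close> has \<open>v\<close>
    and \<open>w\<close> on the same side, opposite to \<open>u\<close>.\<close>
  have AorB: "\<exists>X. X \<in> \<A> \<and> w \<in> X \<or> X \<in> \<B> \<and> w \<notin> X"
    if "f \<in> E" "f \<noteq> e" "N f = {u, w}" "u \<noteq> w" for f w
  proof -
    from bad[OF that] obtain t X where X: "tight t X" "crosses N X e" "crosses N X f" by blast
    then have "(v \<in> X) \<noteq> (u \<in> X)" "(u \<in> X) \<noteq> (w \<in> X)"
      using crosses_pair[of N e v u X] crosses_pair[of N f u w X] e that by auto
    moreover have "t = v" if "v \<in> X" using X(1) that v unfolding tight_def by auto
    ultimately show ?thesis using X(1) unfolding \<A>_def \<B>_def by blast
  qed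
  have Amax: "\<exists>A\<in>\<A>. \<forall>X\<in>\<A>. X \<subseteq> A" if "\<A> \<noteq> {}"
  proof -
    from finite_has_maximal[OF fAB(1) that]
    obtain A where A: "A \<in> \<A>" "\<forall>X\<in>\<A>. A \<subseteq> X \<longrightarrow> A = X" by auto
    have "A \<union> X \<in> \<A>" if "X \<in> \<A>" for X using un that A(1) unfolding \<A>_def by blast
    then have "X \<subseteq> A" if "X \<in> \<A>" for X using A(2) that by (metis Un_upper1 Un_upper2)
    then show ?thesis using A(1) by auto
  qed
  have Bmin: "\<exists>B\<in>\<B>. \<forall>X\<in>\<B>. B \<subseteq> X" if "\<B> \<noteq> {}"
  proof -
    from finite_has_minimal[OF fAB(2) that]
    obtain B where B: "B \<in> \<B>" "\<forall>X\<in>\<B>. X \<subseteq> B \<longrightarrow> B = X" by auto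
    have "B \<inter> X \<in> \<B>" if "X \<in> \<B>" for X
      using un same that B(1) unfolding \<B>_def by blast
    then have "B \<subseteq> X" if "X \<in> \<B>" for X using B(2) that by (metis Int_lower1 Int_lower2)
    then show ?thesis using B(1) by auto
  qed
  have ends_u: "\<exists>w. N g = {u, w} \<and> u \<noteq> w" if "g \<in> E" "u \<in> N g" for g
    using two that by (fastforce simp: card_2_iff)
  have ins: "(insert u A) \<subseteq> V \<and> insert u A \<inter> T = {v}" if "A \<in> \<A>" for A
    using that uV u unfolding \<A>_def tight_def by auto
  have rem: "\<exists>t. tight t B \<and> B - {u} \<subseteq> V \<and> (B - {u}) \<inter> T = {t}" if "B \<in> \<B>" for B
  proof -
    from that obtain t where "tight t B" unfolding \<B>_def by auto
    moreover have "(B - {u}) \<inter> T = B \<inter> T" using u by auto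
    ultimately show ?thesis by (intro exI[of _ t]) (auto simp: tight_def)
  qed
  have Ae: "v \<in> A" "u \<notin> A" if "A \<in> \<A>" for A using that unfolding \<A>_def tight_def by auto
  have Be: "v \<notin> B" "u \<in> B" if "B \<in> \<B>" for B using that unfolding \<B>_def tight_def by auto
  consider "\<A> = {}" "\<B> = {}" | "\<A> \<noteq> {}" "\<B> = {}" | "\<A> = {}" "\<B> \<noteq> {}" | "\<A> \<noteq> {}" "\<B> \<noteq> {}" by blast
  then show False
  proof cases
    case 1
    then have only: "u \<notin> N g" if "g \<in> E" "g \<noteq> e" for g using AorB ends_u that by blast
    \<comment> \<open>Here \<open>e\<close> is the only edge at \<open>u\<close>, so adding
      \<open>u\<close> to \<open>{v}\<close> changes the cut by exactly one, against the parity
      clause.\<close>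
    have "{g \<in> E. crosses N {v} g} = insert e {g \<in> E. crosses N {v, u} g}"
    proof -
      have "crosses N {v} g \<longleftrightarrow> crosses N {v, u} g" if "g \<in> E" "g \<noteq> e" for g
        using only[OF that] two that(1) unfolding crosses_def by (auto simp: card_2_iff)
      then show ?thesis
        using e uv crosses_pair[of N e v u "{v}"] crosses_pair[of N e v u "{v, u}"] by auto
    qed
    moreover have "e \<notin> {g \<in> E. crosses N {v, u} g}" using e by (auto simp: crosses_pair)
    ultimately have "?d {v} = Suc (?d {v, u})"
      using fin by (simp add: cut_size_def)
    moreover have "even (?d {v, u}) \<longleftrightarrow> even (?d {v})"
      using par[of "{v, u}" v] u v uV TV by auto
    ultimately show False by simp
  next
    case 2
    obtain A where A: "A \<in> \<A>" "\<forall>X\<in>\<A>. X \<subseteq> A" using Amax 2 by blast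
    \<comment> \<open>All neighbours of \<open>u\<close> lie in \<open>A\<close>, so adding
      \<open>u\<close> to \<open>A\<close> creates no crossing edge and removes \<open>e\<close>.
      The next case is dual, with all neighbours outside \<open>B\<close>.\<close>
    have nb: "w \<in> A" if "g \<in> E" "N g = {u, w}" "u \<noteq> w" for g w
      using AorB[of g w] that e A Ae[OF A(1)] 2 by (cases "g = e") (auto simp: doubleton_eq_iff)
    have "?d (insert u A) < ?d A"
      unfolding cut_size_sum[OF fin(2)]
    proof (rule sum_strict_mono_ex1[OF fin(2)])
      show "\<forall>g\<in>E. of_bool (crosses N (insert u A) g) \<le> (of_bool (crosses N A g) :: nat)"
      proof
        fix g assume g: "g \<in> E"
        show "of_bool (crosses N (insert u A) g) \<le> (of_bool (crosses N A g) :: nat)"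
        proof (cases "u \<in> N g")
          case True
          then obtain w where "N g = {u, w}" "u \<noteq> w" using ends_u g by blast
          then show ?thesis using nb[OF g] by (auto simp: crosses_pair)
        qed (auto simp: crosses_def)
      qed
      show "\<exists>g\<in>E. of_bool (crosses N (insert u A) g) < (of_bool (crosses N A g) :: nat)"
        using e Ae[OF A(1)] by (intro bexI[of _ e]) (auto simp: crosses_pair)
    qed
    moreover have "?d A \<le> ?d (insert u A)"
      using min[of v A "insert u A"] ins[OF A(1)] A(1) unfolding \<A>_def by simp
    ultimately show False by simp
  next
    case 3
    obtain B where B: "B \<in> \<B>" "\<forall>X\<in>\<B>. B \<subseteq> X" using Bmin 3 by blast
    have nb: "w \<notin> B" if "g \<in> E" "N g = {u, w}" "u \<noteq> w" for g w
      using AorB[of g w] that e B Be[OF B(1)] 3 by (cases "g = e") (auto simp: doubleton_eq_iff)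
    have "?d (B - {u}) < ?d B"
      unfolding cut_size_sum[OF fin(2)]
    proof (rule sum_strict_mono_ex1[OF fin(2)])
      show "\<forall>g\<in>E. of_bool (crosses N (B - {u}) g) \<le> (of_bool (crosses N B g) :: nat)"
      proof
        fix g assume g: "g \<in> E"
        show "of_bool (crosses N (B - {u}) g) \<le> (of_bool (crosses N B g) :: nat)"
        proof (cases "u \<in> N g")
          case True
          then obtain w where "N g = {u, w}" "u \<noteq> w" using ends_u g by blast
          then show ?thesis using nb[OF g] by (auto simp: crosses_pair)
        qed (auto simp: crosses_def)
      qed
      show "\<exists>g\<in>E. of_bool (crosses N (B - {u}) g) < (of_bool (crosses N B g) :: nat)"
        using e Be[OF B(1)] by (intro bexI[of _ e]) (auto simp: crosses_pair)
    qed
    moreover from rem[OF B(1)] have "?d B \<le> ?d (B - {u})" using min by meson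
    ultimately show False by simp
  next
    case 4
    obtain A where A: "A \<in> \<A>" "\<forall>X\<in>\<A>. X \<subseteq> A" using Amax 4 by blast
    obtain B where B: "B \<in> \<B>" "\<forall>X\<in>\<B>. B \<subseteq> X" using Bmin 4 by blast
    have nb: "w \<in> A \<or> w \<notin> B" if "g \<in> E" "N g = {u, w}" "u \<noteq> w" for g w
      using AorB[of g w] that e A Ae[OF A(1)] B by (cases "g = e") (auto simp: doubleton_eq_iff)
    \<comment> \<open>Only the sum of the two cuts is controlled. For an edge \<open>uw\<close>, the
      contribution is unchanged if \<open>w\<close> is in both sets or in neither, and falls from
      two to zero if \<open>w\<close> is in \<open>A\<close> but not in \<open>B\<close>;
      \<open>nb\<close> excludes the remaining position. The edge \<open>e\<close> is of the
      decreasing type.\<close>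
    have "?d (insert u A) + ?d (B - {u}) < ?d A + ?d B"
      unfolding cut_size_sum[OF fin(2)] sum.distrib[symmetric]
    proof (rule sum_strict_mono_ex1[OF fin(2)])
      show "\<forall>g\<in>E. of_bool (crosses N (insert u A) g) + of_bool (crosses N (B - {u}) g)
          \<le> (of_bool (crosses N A g) + of_bool (crosses N B g) :: nat)"
      proof
        fix g assume g: "g \<in> E"
        show "of_bool (crosses N (insert u A) g) + of_bool (crosses N (B - {u}) g)
          \<le> (of_bool (crosses N A g) + of_bool (crosses N B g) :: nat)"
        proof (cases "u \<in> N g")
          case True
          then obtain w where "N g = {u, w}" "u \<noteq> w" using ends_u g by blast
          then show ?thesis using nb[OF g] Ae[OF A(1)] Be[OF B(1)] by (auto simp: crosses_pair)
        next
          case False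
          then have "crosses N (insert u A) g = crosses N A g" "crosses N (B - {u}) g = crosses N B g"
            by (auto simp: crosses_def)
          then show ?thesis by simp
        qed
      qed
      show "\<exists>g\<in>E. of_bool (crosses N (insert u A) g) + of_bool (crosses N (B - {u}) g)
          < (of_bool (crosses N A g) + of_bool (crosses N B g) :: nat)"
        using e Ae[OF A(1)] Be[OF B(1)] by (intro bexI[of _ e]) (auto simp: crosses_pair)
    qed
    moreover from rem[OF B(1)] have "?d B \<le> ?d (B - {u})" using min by meson
    moreover have "?d A \<le> ?d (insert u A)"
      using min[of v A "insert u A"] ins[OF A(1)] A(1) unfolding \<A>_def by simp
    ultimately show False by simp
  qed
qed


section \<open>Packing joins in a multigraph on the four terminals\<close>

text \<open>Every edge now joins two terminals, so the cut of a single terminal is its degree. The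
  induction on the number of edges either removes a perfect matching and lowers \<open>k\<close>, or
  removes an edge while spending surplus degree at a terminal; the remaining configuration is
  impossible.\<close>

lemma packable_terminals_only:
  assumes "finite E" "\<forall>e\<in>E. N e \<subseteq> {a, b, c, d} \<and> card (N e) = 2" "distinct [a, b, c, d]"
    and "\<forall>t\<in>{a, b, c, d}. k \<le> cut_size E N {t}"
  shows "packable E N {a, b, c, d} k"
  using assms(1,2,4)
proof (induction "card E" arbitrary: E N k rule: less_induct)
  case less
  let ?T = "{a, b, c, d}"
  note fin = less.prems(1) and NT = less.prems(2) and deg = less.prems(3)
  have incident: "crosses N {t} e \<longleftrightarrow> t \<in> N e" if "e \<in> E" for t e
    using NT that by (auto simp: crosses_def card_2_iff)
  consider "k = 0"
    | e f where "k > 0" "e \<in> E" "f \<in> E" "N e \<inter> N f = {}"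
    | t where "t \<in> ?T" "k + 2 \<le> cut_size E N {t}"
    | "k > 0" "\<And>e f. e \<in> E \<Longrightarrow> f \<in> E \<Longrightarrow> N e \<inter> N f \<noteq> {}" "\<And>t. t \<in> ?T \<Longrightarrow> cut_size E N {t} \<le> k + 1"
    by (metis Suc_eq_plus1 add_2_eq_Suc' gr0I not_less_eq_eq)
  then show ?case
  proof cases
    case 1
    then show ?thesis by (simp add: packable_def)
  next
    case 2
    \<comment> \<open>Two disjoint edges cover all four terminals: together they form a join, and
      their removal costs each terminal one edge.\<close>
    have "card (N e \<union> N f) = 4"
      using NT 2 by (subst card_Un_disjoint) (auto intro: card_ge_0_finite)
    then have un: "N e \<union> N f = ?T"
      using NT 2 assms(3) by (intro card_subset_eq) auto
    have "e \<noteq> f" using 2 NT by force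
    let ?R = "E - {e, f}"
    have R: "finite ?R" "e \<notin> ?R" "f \<notin> insert e ?R" and E: "E = insert f (insert e ?R)"
      using fin 2 \<open>e \<noteq> f\<close> by auto
    have cut: "cut_size E N X = of_bool (crosses N X f) + (of_bool (crosses N X e) + cut_size ?R N X)" for X
      using cut_size_insert[OF _ R(3), of N X] cut_size_insert[OF R(1,2), of N X] R(1) E
      by (metis finite_insert)
    have "k - 1 \<le> cut_size ?R N {t}" if "t \<in> ?T" for t
    proof -
      have "\<not> (crosses N {t} e \<and> crosses N {t} f)" using 2 incident by auto
      then have "cut_size E N {t} \<le> Suc (cut_size ?R N {t})" using cut[of "{t}"] by auto
      moreover have "k \<le> cut_size E N {t}" using deg that by blast
      ultimately show ?thesis by simp
    qed
    moreover have "card ?R < card E" using fin 2 by (intro psubset_card_mono) auto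
    ultimately have "packable ?R N ?T (k - 1)" using less.hyps[of ?R N "k - 1"] R(1) NT by blast
    moreover have "tjoin E N ?T {e, f}"
    proof -
      have "{g \<in> {e, f}. x \<in> N g} = (if x \<in> N e then {e} else if x \<in> N f then {f} else {})" for x
        using 2 by auto
      then have "card {g \<in> {e, f}. x \<in> N g} = of_bool (x \<in> N e \<union> N f)" for x by simp
      then show ?thesis using 2 un by (simp add: tjoin_def)
    qed
    ultimately have "packable E N ?T (Suc (k - 1))"
      using packable_add[of ?R N ?T "k - 1" E "{e, f}"] by auto
    then show ?thesis using 2 by simp
  next
    case 3
    then have "{e \<in> E. crosses N {t} e} \<noteq> {}" by (auto simp: cut_size_def simp del: Collect_empty_eq)
    then obtain e where e: "e \<in> E" "t \<in> N e" using incident by auto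
    then obtain x where x: "N e = {x, t}" "x \<noteq> t" using NT by (fastforce simp: card_2_iff)
    show ?thesis
    \<comment> \<open>If \<open>t\<close> has two distinct neighbours \<open>x\<close> and
      \<open>y\<close>, splitting there costs \<open>t\<close> two edges and the other terminals
      none. Otherwise every edge at \<open>t\<close> is parallel to \<open>e\<close>, so
      \<open>x\<close> has at least the degree of \<open>t\<close>, and both ends of
      \<open>e\<close> can afford its deletion.\<close>
    proof (cases "\<exists>f\<in>E. t \<in> N f \<and> N f \<noteq> N e")
      case True
      then obtain f where f: "f \<in> E" "t \<in> N f" "N f \<noteq> N e" by blast
      then obtain y where y: "N f = {t, y}" "y \<noteq> t" using NT by (fastforce simp: card_2_iff)
      have ne: "e \<noteq> f" "x \<noteq> y" using f x y by auto
      let ?N = "N(e := {x, y})"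
      have "k \<le> cut_size (E - {f}) ?N {s}" if "s \<in> ?T" for s
      proof (cases "s = t")
        case True
        then show ?thesis using 3 cut_size_split[OF fin e(1) f(1) ne(1) x(1) y(1), of "{s}"]
          by (auto simp: of_bool_def split: if_splits)
      next
        case False
        then have "\<not> (crosses N {s} e \<and> crosses N {s} f)"
          using incident e f x y ne by auto
        moreover have "k \<le> cut_size E N {s}" using deg that by blast
        ultimately show ?thesis
          using cut_size_split[OF fin e(1) f(1) ne(1) x(1) y(1), of "{s}"]
          by (auto simp: of_bool_def split: if_splits)
      qed
      moreover have "\<forall>g\<in>E - {f}. ?N g \<subseteq> ?T \<and> card (?N g) = 2"
      proof
        fix g assume g: "g \<in> E - {f}"
        have "{x, y} \<subseteq> N e \<union> N f" using x y by auto
        then have "{x, y} \<subseteq> ?T" using NT e f by blast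
        then show "?N g \<subseteq> ?T \<and> card (?N g) = 2" using NT g ne(2) by (cases "g = e") simp_all
      qed
      moreover have "card (E - {f}) < card E" using fin f by (intro psubset_card_mono) auto
      ultimately have "packable (E - {f}) ?N ?T k" using less.hyps[of "E - {f}" ?N k] fin by simp
      then show ?thesis
        using packable_split fin e(1) f(1) ne x y by metis
    next
      case False
      have tx: "cut_size E N {t} \<le> cut_size E N {x}"
        unfolding cut_size_def using fin False incident x by (intro card_mono) auto
      have cut: "cut_size E N {s} = of_bool (crosses N {s} e) + cut_size (E - {e}) N {s}" for s
        using cut_size_insert[of "E - {e}" e N "{s}"] fin e by (simp add: insert_absorb)
      have "k \<le> cut_size (E - {e}) N {s}" if s: "s \<in> ?T" for s
      proof (cases "s \<in> {t, x}")
        case True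
        then have "k + 2 \<le> cut_size E N {s}" using 3(2) tx by auto
        moreover have "of_bool (crosses N {s} e) \<le> (1 :: nat)" by simp
        ultimately show ?thesis using cut[of s] by linarith
      next
        case False
        then have "\<not> crosses N {s} e" using incident e(1) x by auto
        moreover have "k \<le> cut_size E N {s}" using deg s by blast
        ultimately show ?thesis using cut[of s] by simp
      qed
      moreover have "card (E - {e}) < card E" using fin e by (intro psubset_card_mono) auto
      ultimately have "packable (E - {e}) N ?T k" using less.hyps[of "E - {e}" N k] fin NT by blast
      then show ?thesis by (rule packable_mono) auto
    qed
  next
    case 4
    txt \<open>Pairwise intersecting edges on four vertices form a star or a triangle, so some degree is
      too large or zero.\<close>
    define n where "n x y = card {e \<in> E. N e = {x, y}}" for x y
    have n_sum: "cut_size E N {t} = n t x + n t y + n t z"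
      if T: "{t, x, y, z} = ?T" "distinct [t, x, y, z]" for t x y z
    proof -
      have "{e \<in> E. crosses N {t} e} =
          {e \<in> E. N e = {t, x}} \<union> {e \<in> E. N e = {t, y}} \<union> {e \<in> E. N e = {t, z}}"
      proof -
        have "t \<in> N e \<longleftrightarrow> N e = {t, x} \<or> N e = {t, y} \<or> N e = {t, z}" if e: "e \<in> E" for e
        proof
          assume t: "t \<in> N e"
          then obtain s where "N e = {t, s}" "s \<noteq> t" using NT e by (fastforce simp: card_2_iff)
          moreover from this have "s \<in> {t, x, y, z}" using NT e unfolding T(1) by blast
          ultimately show "N e = {t, x} \<or> N e = {t, y} \<or> N e = {t, z}" by auto
        qed auto
        then show ?thesis using incident by auto
      qed
      moreover have "{t, x} \<noteq> {t, y}" "{t, x} \<noteq> {t, z}" "{t, y} \<noteq> {t, z}"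
        using T(2) by (auto simp: doubleton_eq_iff)
      ultimately show ?thesis
        using fin by (auto simp: cut_size_def n_def card_Un_disjoint disjoint_iff)
    qed
    have comm: "n y x = n x y" for x y by (simp add: n_def insert_commute)
    have zero: "n x y = 0 \<or> n z w = 0" if "distinct [x, y, z, w]" for x y z w
    proof (rule ccontr)
      assume "\<not> ?thesis"
      then obtain e f where "e \<in> E" "N e = {x, y}" "f \<in> E" "N f = {z, w}"
        by (auto simp: n_def card_eq_0_iff)
      then show False using 4(2)[of e f] that by auto
    qed
    \<comment> \<open>Keeping one pair from each of the three perfect matchings leaves a star or a
      triangle. In a star the centre has degree at least \<open>3 * k\<close>, which exceeds
      \<open>k + 1\<close>; beside a triangle the fourth vertex has degree 0.\<close>
    have arith: False
      if "k > 0" "ab = 0 \<or> cd = 0" "ac = 0 \<or> bd = 0" "ad = 0 \<or> bc = 0"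
        "k \<le> ab + ac + ad" "ab + ac + ad \<le> k + 1" "k \<le> ab + bc + bd" "ab + bc + bd \<le> k + 1"
        "k \<le> ac + bc + cd" "ac + bc + cd \<le> k + 1" "k \<le> ad + bd + cd" "ad + bd + cd \<le> k + 1"
      for ab ac ad bc bd cd :: nat
      using that(2-4) by (elim disjE) (use that(1,5-) in linarith)+
    have "cut_size E N {a} = n a b + n a c + n a d" "cut_size E N {b} = n a b + n b c + n b d"
      "cut_size E N {c} = n a c + n b c + n c d" "cut_size E N {d} = n a d + n b d + n c d"
      using n_sum[of a b c d] n_sum[of b a c d] n_sum[of c a b d] n_sum[of d a b c] assms(3)
      by (auto simp: insert_commute comm[of b a] comm[of c a] comm[of d a] comm[of c b] comm[of d b] comm[of d c])
    moreover have "k \<le> cut_size E N {t} \<and> cut_size E N {t} \<le> k + 1" if "t \<in> ?T" for t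
      using deg 4(3) that by blast
    ultimately show ?thesis
      using arith[OF 4(1) zero[of a b c d] zero[of a c b d] zero[of a d b c]] assms(3) by force
  qed
qed

section \<open>Reduction of feasible instances to the four terminals\<close>

lemma feasible_imp_packable:
  assumes "feasible V E N {a, b, c, d} k" "distinct [a, b, c, d]"
  shows "packable E N {a, b, c, d} k"
  using assms(1)
proof (induction "card E" arbitrary: E N rule: less_induct)
  case less
  let ?T = "{a, b, c, d}"
  have fin: "finite V" "finite E" and TV: "?T \<subseteq> V"
    and N: "\<forall>e\<in>E. N e \<subseteq> V \<and> card (N e) = 2"
    and cut: "\<forall>t. \<forall>X\<subseteq>V. X \<inter> ?T = {t} \<longrightarrow>
      k \<le> cut_size E N X \<and> (even (cut_size E N X) \<longleftrightarrow> even (cut_size E N {t}))"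
    using less.prems unfolding feasible_def by simp_all
  show ?case
  proof (cases "\<exists>e\<in>E. \<exists>v\<in>?T. \<exists>u. u \<notin> ?T \<and> N e = {v, u}")
    case True
    then obtain e v u where e: "e \<in> E" "N e = {v, u}" and v: "v \<in> ?T" and u: "u \<notin> ?T" by blast
    obtain f w where f: "f \<in> E" "f \<noteq> e" "N f = {u, w}" "u \<noteq> w"
      and adm: "\<And>X t. X \<subseteq> V \<Longrightarrow> X \<inter> ?T = {t} \<Longrightarrow> crosses N X e \<Longrightarrow> crosses N X f \<Longrightarrow>
        k + 2 \<le> cut_size E N X"
      by (rule admissible_split_exists[OF less.prems e v u]) blast
    \<comment> \<open>Covers both the proper splitting and the deletion of a parallel pair: the loss
      of 0 or 2 keeps all parities, and a cut that loses 2 had at least \<open>k + 2\<close> edges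
      by admissibility.\<close>
    have keep: "feasible V E' N' ?T k"
      if "E' \<subseteq> E" "\<forall>g\<in>E'. N' g \<subseteq> V \<and> card (N' g) = 2"
        and eq: "\<And>X. cut_size E' N' X + 2 * of_bool (crosses N X e \<and> crosses N X f) = cut_size E N X"
      for E' N'
    proof -
      have par: "even (cut_size E' N' X) \<longleftrightarrow> even (cut_size E N X)" for X
        unfolding eq[of X, symmetric] by simp
      have "k \<le> cut_size E' N' X" if "X \<subseteq> V" "X \<inter> ?T = {t}" for X t
      proof (cases "crosses N X e \<and> crosses N X f")
        case True
        then have "k + 2 \<le> cut_size E N X" using adm that by blast
        then show ?thesis using eq[of X] True by simp
      next
        case False
        have "k \<le> cut_size E N X" using cut that by blast
        then show ?thesis using eq[of X] False by simp
      qed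
      moreover have "even (cut_size E' N' X) \<longleftrightarrow> even (cut_size E' N' {t})"
        if "X \<subseteq> V" "X \<inter> ?T = {t}" for X t
        unfolding par using cut that by blast
      moreover have "finite E'" using that(1) fin(2) by (rule finite_subset)
      ultimately show ?thesis
        unfolding feasible_def using fin(1) TV that(2) by simp
    qed
    show ?thesis
    proof (cases "w = v")
      case True
      have "feasible V (E - {e, f}) N ?T k"
        using cut_size_delete_parallel[of E e f N v u] fin(2) e f True N
        by (intro keep) auto
      moreover have "card (E - {e, f}) < card E" using fin e by (intro psubset_card_mono) auto
      ultimately have "packable (E - {e, f}) N ?T k" using less.hyps by blast
      then show ?thesis by (rule packable_mono) auto
    next
      case False
      have "{v, w} \<subseteq> V" "card {v, w} = 2" using N e f False by auto
      then have "feasible V (E - {f}) (N(e := {v, w})) ?T k"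
        using cut_size_split[OF fin(2) e(1) f(1) f(2)[symmetric] e(2) f(3)] N
        by (intro keep) auto
      moreover have "card (E - {f}) < card E" using fin f by (intro psubset_card_mono) auto
      ultimately have "packable (E - {f}) (N(e := {v, w})) ?T k" using less.hyps by blast
      moreover have "u \<noteq> v" using u v by auto
      ultimately show ?thesis
        using packable_split fin(2) e(1) f(1) f(2)[symmetric] e(2) f(3,4) False by metis
    qed
  next
    case False
    \<comment> \<open>Edges at terminals now stay among the terminals, so discarding all other edges
      leaves the terminal degrees unchanged.\<close>
    have "N e \<subseteq> ?T" if e: "e \<in> E" "t \<in> N e" "t \<in> ?T" for e t
    proof -
      have "card (N e) = 2" using N e by blast
      then obtain x y where "N e = {x, y}" by (auto simp: card_2_iff)
      then have "N e = {t, x} \<or> N e = {t, y}" using e(2) by auto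
      then obtain x where x: "N e = {t, x}" by blast
      then have "x \<in> ?T" using False e by blast
      then show ?thesis using x e by simp
    qed
    then have "{e \<in> E. crosses N {t} e} \<subseteq> {e \<in> {e \<in> E. N e \<subseteq> ?T}. crosses N {t} e}" if "t \<in> ?T" for t
      using that by (auto simp: crosses_def simp del: insert_iff)
    then have "cut_size E N {t} \<le> cut_size {e \<in> E. N e \<subseteq> ?T} N {t}" if "t \<in> ?T" for t
      unfolding cut_size_def using that fin by (intro card_mono) auto
    moreover have "k \<le> cut_size E N {t}" if "t \<in> ?T" for t
    proof -
      have "{t} \<subseteq> V" "{t} \<inter> ?T = {t}" using that TV by auto
      then show ?thesis using cut by blast
    qed
    ultimately have "\<forall>t\<in>?T. k \<le> cut_size {e \<in> E. N e \<subseteq> ?T} N {t}" by (meson order_trans)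
    moreover have "finite {e \<in> E. N e \<subseteq> ?T}" using fin(2) by simp
    moreover have "\<forall>e\<in>{e \<in> E. N e \<subseteq> ?T}. N e \<subseteq> ?T \<and> card (N e) = 2" using N by blast
    ultimately have "packable {e \<in> E. N e \<subseteq> ?T} N ?T k"
      using packable_terminals_only[OF _ _ assms(2)] by blast
    then show ?thesis by (rule packable_mono) auto
  qed
qed


section \<open>Chains as joins, and robustness as feasibility\<close>

lemma of_nat_bit: "(of_nat n :: bit) = of_bool (odd n)"
  by (induction n) auto

lemma lookup_boundary:
  assumes "\<forall>e\<in>Poly_Mapping.keys c. finite (ends G e)"
  shows "Poly_Mapping.lookup (boundary G c) x
    = of_bool (odd (card {e \<in> Poly_Mapping.keys c. x \<in> ends G e}))"
proof -
  have "Poly_Mapping.lookup (boundary G c) x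
      = (\<Sum>e\<in>Poly_Mapping.keys c. \<Sum>v\<in>ends G e. of_bool (v = x))"
    by (simp add: boundary_def gen_def lookup_sum lookup_single when_def of_bool_def)
  also have "\<dots> = (\<Sum>e\<in>Poly_Mapping.keys c. of_bool (x \<in> ends G e))"
  proof (rule sum.cong)
    fix e assume "e \<in> Poly_Mapping.keys c"
    then have "finite (ends G e)" using assms by blast
    then show "(\<Sum>v\<in>ends G e. of_bool (v = x)) = (of_bool (x \<in> ends G e) :: bit)"
      by (simp add: of_bool_def)
  qed simp
  also have "\<dots> = of_nat (card (Poly_Mapping.keys c \<inter> {e. x \<in> ends G e}))"
    by simp
  finally show ?thesis by (simp add: of_nat_bit Int_def)
qed

text \<open>The coefficient of \<open>x\<close> in the boundary is the parity of its degree in the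
  chain. Distinctness prevents cancellation among the four generators, so their sum has coefficient
  1 exactly at these vertices.\<close>

lemma chain_iff_tjoin:
  assumes "\<forall>e\<in>edges G. card (ends G e) = 2" "distinct [a, b, c, d]"
  shows "p \<in> chains_on (edges G) \<and> boundary G p = gen a + gen b + gen c + gen d
    \<longleftrightarrow> tjoin (edges G) (ends G) {a, b, c, d} (Poly_Mapping.keys p)"
proof (cases "Poly_Mapping.keys p \<subseteq> edges G")
  case True
  then have "\<forall>e\<in>Poly_Mapping.keys p. finite (ends G e)"
    using assms(1) by (metis card.infinite subsetD zero_neq_numeral)
  note L = lookup_boundary[OF this]
  have "Poly_Mapping.lookup (gen a + gen b + gen c + gen d) x = (of_bool (x \<in> {a, b, c, d}) :: bit)" for x
    using assms(2) by (auto simp: gen_def lookup_add lookup_single when_def)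
  then have "boundary G p = gen a + gen b + gen c + gen d \<longleftrightarrow>
      (\<forall>x. (of_bool (odd (card {e \<in> Poly_Mapping.keys p. x \<in> ends G e})) :: bit) = of_bool (x \<in> {a, b, c, d}))"
    by (simp only: poly_mapping_eq_iff fun_eq_iff L)
  then show ?thesis using True by (simp only: tjoin_def chains_on_def of_bool_eq_iff mem_Collect_eq)
qed (simp add: tjoin_def chains_on_def)

lemma ex_chain_keys:
  assumes "finite S"
  shows "\<exists>c :: 'a chain. Poly_Mapping.keys c = S"
  using assms
proof induction
  case empty
  show ?case by (rule exI[of _ 0]) simp
next
  case (insert x S)
  then obtain c :: "'a chain" where "Poly_Mapping.keys c = S" by blast
  then have "Poly_Mapping.keys (gen x + c) = insert x S"
    using insert(2) by (auto simp: keys_add_chain gen_def)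
  then show ?case by blast
qed

text \<open>If no edge of \<open>p\<close> crossed \<open>X\<close>, the degrees of \<open>p\<close>
  would have an even sum over \<open>X\<close>. Then \<open>X\<close> would contain an even number
  of vertices of \<open>T\<close>, but it contains exactly one.\<close>

lemma tjoin_crosses_cut:
  assumes "tjoin E N T p" "finite E" "\<forall>e\<in>E. card (N e) = 2" "finite X" "X \<inter> T = {t}"
  shows "\<exists>e\<in>p. crosses N X e"
proof (rule ccontr)
  assume "\<not> ?thesis"
  then have "{e \<in> p. crosses N X e} = {}" by auto
  then have "cut_size p N X = 0" unfolding cut_size_def by (simp only: card.empty)
  moreover have p: "finite p" "\<forall>e\<in>p. card (N e) = 2"
    using assms by (auto simp: tjoin_def intro: finite_subset)
  ultimately have "even (\<Sum>x\<in>X. card {e \<in> p. x \<in> N e})"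
    using cut_size_parity[OF p assms(4)] by simp
  then have "even (card {x \<in> X. odd (card {e \<in> p. x \<in> N e})})"
    unfolding even_sum_iff[OF assms(4)] .
  moreover have "{x \<in> X. odd (card {e \<in> p. x \<in> N e})} = X \<inter> T"
    using assms(1) by (auto simp: tjoin_def)
  ultimately show False using assms(5) by simp
qed

text \<open>A cut around one terminal with fewer than \<open>k\<close> edges could be deleted
  entirely, yet the surviving join would have to cross it. For parity, the cut of \<open>X\<close>
  has the parity of its degree sum, to which all vertices but \<open>t\<close> contribute even
  numbers.\<close>

lemma feasible_if_tjoin_survives:
  assumes "finite V" "finite E" "T \<subseteq> V" "\<forall>e\<in>E. N e \<subseteq> V \<and> card (N e) = 2"
    and even: "\<forall>y\<in>V - T. even (card {e \<in> E. y \<in> N e})"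
    and survives: "\<forall>F\<subseteq>E. card F < k \<longrightarrow> (\<exists>p. tjoin (E - F) N T p)"
  shows "feasible V E N T k"
proof -
  have two: "\<forall>e\<in>E. card (N e) = 2" using assms(4) by blast
  have "k \<le> cut_size E N X \<and> (even (cut_size E N X) \<longleftrightarrow> even (cut_size E N {t}))"
    if X: "X \<subseteq> V" "X \<inter> T = {t}" for X t
  proof
    have finX: "finite X" using X(1) assms(1) by (rule finite_subset)
    show "k \<le> cut_size E N X"
    proof (rule ccontr)
      let ?F = "{e \<in> E. crosses N X e}"
      assume "\<not> ?thesis"
      then obtain p where p: "tjoin (E - ?F) N T p"
        using survives[rule_format, of ?F] by (auto simp: cut_size_def)
      moreover have "\<forall>e\<in>p. \<not> crosses N X e" using p by (auto simp: tjoin_def)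
      ultimately show False
        using tjoin_crosses_cut[OF p _ _ finX X(2)] assms(2) two by auto
    qed
    have "(\<Sum>x\<in>X. card {e \<in> E. x \<in> N e})
        = card {e \<in> E. t \<in> N e} + (\<Sum>x\<in>X - {t}. card {e \<in> E. x \<in> N e})"
      using finX X(2) by (intro sum.remove) auto
    moreover have "even (\<Sum>x\<in>X - {t}. card {e \<in> E. x \<in> N e})"
      using even X by (intro dvd_sum) blast
    ultimately have "even (\<Sum>x\<in>X. card {e \<in> E. x \<in> N e}) \<longleftrightarrow> even (\<Sum>x\<in>{t}. card {e \<in> E. x \<in> N e})"
      by simp
    then show "even (cut_size E N X) \<longleftrightarrow> even (cut_size E N {t})"
      using cut_size_parity[OF assms(2) two finX] cut_size_parity[OF assms(2) two, of "{t}"] by simp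
  qed
  then show ?thesis unfolding feasible_def using assms(1-4) by blast
qed

section \<open>Transfer to chains in the given graph\<close>

theorem theorem2p10:
  fixes k :: nat
    and G :: "('v, 'e) multigraph"
    and v1 v2 v3 v4 :: 'v
  assumes "k > 0"
    and "finite_multigraph G"
    and "{v1, v2, v3, v4} \<subseteq> verts G"
    and "distinct [v1, v2, v3, v4]"
  shows "(\<exists>p :: nat \<Rightarrow> 'e chain.
            (\<forall>i\<in>{1..k}. p i \<in> chains_on (edges G) \<and>
               boundary G (p i) = gen v1 + gen v2 + gen v3 + gen v4) \<and>
            (\<forall>i\<in>{1..k}. \<forall>j\<in>{1..k}. i \<noteq> j \<longrightarrow> no_common_summand (p i) (p j)))
     \<longleftrightarrow>
         (\<exists>D G'. D \<subseteq> edges G \<and> G' = delete_edges G D \<and>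
            (\<forall>y \<in> verts G' - {v1, v2, v3, v4}. even (vertex_degree G' y)) \<and>
            (\<forall>F. F \<subseteq> edges G' \<and> card F \<le> k - 1 \<longrightarrow>
               (\<exists>p \<in> chains_on (edges (delete_edges G' F)).
                  boundary (delete_edges G' F) p = gen v1 + gen v2 + gen v3 + gen v4)))"
    (is "?packing \<longleftrightarrow> ?robust")
proof -
  let ?T = "{v1, v2, v3, v4}" and ?E = "edges G" and ?N = "ends G"
  have G: "finite (verts G)" "finite ?E" "\<forall>e\<in>?E. ?N e \<subseteq> verts G \<and> card (?N e) = 2"
    using assms(2) by (auto simp: finite_multigraph_def)
  have del: "edges (delete_edges H D) = edges H - D" "ends (delete_edges H D) = ends H"
    "verts (delete_edges H D) = verts H" for H :: "('v, 'e) multigraph" and D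
    by (simp_all add: delete_edges_def)
  have chain: "p \<in> chains_on (edges H) \<and> boundary H p = gen v1 + gen v2 + gen v3 + gen v4
      \<longleftrightarrow> tjoin (edges H) ?N ?T (Poly_Mapping.keys p)"
    if "edges H \<subseteq> ?E" "ends H = ?N" for H :: "('v, 'e) multigraph" and p
    using chain_iff_tjoin[OF _ assms(4), of H p] G(3) that by auto
  show ?thesis
  proof
    assume ?packing
    then obtain p :: "nat \<Rightarrow> 'e chain" where
      p: "\<forall>i\<in>{1..k}. p i \<in> chains_on ?E \<and> boundary G (p i) = gen v1 + gen v2 + gen v3 + gen v4"
      and disj: "\<forall>i\<in>{1..k}. \<forall>j\<in>{1..k}. i \<noteq> j \<longrightarrow> no_common_summand (p i) (p j)" by blast
    let ?K = "\<lambda>i. Poly_Mapping.keys (p i)"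
    \<comment> \<open>All edges outside the chains are deleted, so that the remaining graph is their
      disjoint union and its degrees are sums of degrees in joins.\<close>
    define D where "D = ?E - (\<Union>i\<in>{1..k}. ?K i)"
    let ?G' = "delete_edges G D"
    have join: "tjoin ?E ?N ?T (?K i)" if "i \<in> {1..k}" for i
      using p chain[of G "p i"] that by blast
    have "(\<Union>i\<in>{1..k}. ?K i) \<subseteq> ?E" using join unfolding tjoin_def by blast
    then have E': "edges ?G' = (\<Union>i\<in>{1..k}. ?K i)"
      unfolding D_def del by (rule double_diff) simp
    have disj': "?K i \<inter> ?K j = {}" if "i \<in> {1..k}" "j \<in> {1..k}" "i \<noteq> j" for i j
      using disj that unfolding no_common_summand_def by blast
    have "even (vertex_degree ?G' y)" if y: "y \<notin> ?T" for y
    proof -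
      have "{e \<in> edges ?G'. y \<in> ?N e} = (\<Union>i\<in>{1..k}. {e \<in> ?K i. y \<in> ?N e})"
        unfolding E' by blast
      then have "vertex_degree ?G' y = (\<Sum>i\<in>{1..k}. card {e \<in> ?K i. y \<in> ?N e})"
        unfolding vertex_degree_def del(2) using disj' by (simp add: card_UN_disjoint disjoint_iff)
      also have "even \<dots>"
      proof (rule dvd_sum)
        fix i assume "i \<in> {1..k}"
        then show "even (card {e \<in> ?K i. y \<in> ?N e})" using join y unfolding tjoin_def by blast
      qed
      finally show ?thesis .
    qed
    moreover have "\<exists>q \<in> chains_on (edges (delete_edges ?G' F)).
        boundary (delete_edges ?G' F) q = gen v1 + gen v2 + gen v3 + gen v4"
      if F: "F \<subseteq> edges ?G'" "card F \<le> k - 1" for F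
    proof -
      have finF: "finite F" using F(1) unfolding E' by (rule finite_subset) simp
      \<comment> \<open>Pigeonhole: if \<open>F\<close> met every chain, choosing one common edge
        for each would inject \<open>{1..k}\<close> into \<open>F\<close>. Positivity of
        \<open>k\<close> makes the bound \<open>k - 1\<close> strictly smaller than
        \<open>k\<close>.\<close>
      have "\<exists>i\<in>{1..k}. ?K i \<inter> F = {}"
      proof (rule ccontr)
        assume "\<not> ?thesis"
        then have "\<forall>i\<in>{1..k}. \<exists>e. e \<in> ?K i \<inter> F" by blast
        then obtain g where g: "\<forall>i\<in>{1..k}. g i \<in> ?K i \<inter> F" by metis
        then have "inj_on g {1..k}" using disj' by (fastforce simp: inj_on_def)
        then have "card {1..k} \<le> card F" using g finF by (intro card_inj_on_le) auto
        then show False using F(2) assms(1) by simp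
      qed
      then obtain i where i: "i \<in> {1..k}" "?K i \<inter> F = {}" by blast
      then have "tjoin (edges (delete_edges ?G' F)) ?N ?T (?K i)"
        using join[OF i(1)] E' by (auto simp: tjoin_def del(1)[of ?G'])
      then show ?thesis
        using chain[of "delete_edges ?G' F" "p i"] by (auto simp: del)
    qed
    ultimately show ?robust
      by (intro exI[of _ D] exI[of _ ?G']) (auto simp: D_def)
  next
    assume ?robust
    then obtain D where "D \<subseteq> ?E"
      and even: "\<forall>y \<in> verts G - ?T. even (vertex_degree (delete_edges G D) y)"
      and survives: "\<And>F. F \<subseteq> ?E - D \<Longrightarrow> card F \<le> k - 1 \<Longrightarrow>
        \<exists>p \<in> chains_on (edges (delete_edges (delete_edges G D) F)).
          boundary (delete_edges (delete_edges G D) F) p = gen v1 + gen v2 + gen v3 + gen v4"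
      by (auto simp only: del)
    have "feasible (verts G) (?E - D) ?N ?T k"
    proof (rule feasible_if_tjoin_survives)
      show "\<forall>y\<in>verts G - ?T. even (card {e \<in> ?E - D. y \<in> ?N e})"
        using even by (simp add: vertex_degree_def del)
      show "\<forall>F\<subseteq>?E - D. card F < k \<longrightarrow> (\<exists>p. tjoin (?E - D - F) ?N ?T p)"
      proof (intro allI impI)
        fix F assume F: "F \<subseteq> ?E - D" "card F < k"
        let ?H = "delete_edges (delete_edges G D) F"
        have "card F \<le> k - 1" using F(2) by simp
        from survives[OF F(1) this] obtain p where "p \<in> chains_on (edges ?H)"
          "boundary ?H p = gen v1 + gen v2 + gen v3 + gen v4" by blast
        then have "tjoin (edges ?H) ?N ?T (Poly_Mapping.keys p)"
          using chain[of ?H p] by (auto simp: del)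
        then show "\<exists>p. tjoin (?E - D - F) ?N ?T p" by (auto simp: del)
      qed
    qed (use G assms(3) in auto)
    then have "packable ?E ?N ?T k"
      using feasible_imp_packable assms(4) packable_mono by (metis Diff_subset)
    then obtain P where P: "\<forall>i<k. tjoin ?E ?N ?T (P i)"
      "\<forall>i<k. \<forall>j<k. i \<noteq> j \<longrightarrow> P i \<inter> P j = {}" by (auto simp: packable_def)
    have "\<exists>c :: 'e chain. Poly_Mapping.keys c = P i" if "i < k" for i
      using P(1) that G(2) by (intro ex_chain_keys) (auto simp: tjoin_def intro: finite_subset)
    then obtain c :: "nat \<Rightarrow> 'e chain" where c: "\<And>i. i < k \<Longrightarrow> Poly_Mapping.keys (c i) = P i" by metis
    show ?packing
    \<comment> \<open>Packings are indexed from 0 and the chains of the theorem from 1, hence the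
      shift.\<close>
    proof (intro exI[of _ "\<lambda>i. c (i - 1)"] conjI ballI impI)
      fix i assume "i \<in> {1..k}"
      then have "tjoin ?E ?N ?T (Poly_Mapping.keys (c (i - 1)))" using P(1) c by auto
      then show "c (i - 1) \<in> chains_on ?E" "boundary G (c (i - 1)) = gen v1 + gen v2 + gen v3 + gen v4"
        using chain[of G] by blast+
    next
      fix i j assume "i \<in> {1..k}" "j \<in> {1..k}" "i \<noteq> j"
      then have "i - 1 < k" "j - 1 < k" "i - 1 \<noteq> j - 1" by auto
      then show "no_common_summand (c (i - 1)) (c (j - 1))"
        using P(2) c by (simp add: no_common_summand_def)
    qed
  qed
qed

end
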